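(* Let $N\ge 2$ be an integer, let $\omega\in\mathbb{R}$, and let $m_1,\dots,m_N,m_{N+1}>0$ be masses. Identify $\mathbb{R}^2$ with $\mathbb{C}$. Place the body of mass $m_j$ at the vertex $x_j=e^{2\pi i j/N}$ of the regular $N$-polygon for $j=1,\dots,N$, and place the $(N+1)$-th body, of mass $m_{N+1}$, at the geometric center $x_{N+1}=0$ of this polygon. Then the $N+1$ bodies form a planar central configuration (with angular velocity $\omega$) if and only if $$m_1=m_2=\cdots=m_N=\frac{\omega^2-m_{N+1}}{\frac14\sum_{j=1}^{N-1}\csc\frac{j\pi}{N}}.$$
   Context: Positions $x_1,\dots,x_{N+1}\in\mathbb{R}^2\cong\mathbb{C}$, pairwise distinct, with positive masses $m_1,\dots,m_{N+1}$, form a planar central configuration with angular velocity $\omega$ if for every $k=1,\dots,N+1$ $$\sum_{\substack{1\le j\le N+1\\ j\ne k}}\frac{m_jm_k}{|x_j-x_k|^3}(x_j-x_k)=-\omega^2 m_k(x_k-c_0),\qquad c_0=\frac{\sum_{j=1}^{N+1}m_jx_j}{\sum_{j=1}^{N+1}m_j}.$$ Here $c_0$ is the center of masses of the $N+1$ bodies; it is not assumed in advance that $c_0=0$. For $N=2$ the "regular $2$-polygon" is the pair of points $\{-1,1\}$, with geometric center $0$. *)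

theory Defs
  imports "HOL-Analysis.Analysis"
begin

text \<open>Bodies are indexed by \<open>1, \<dots>, n\<close>; the values of \<open>m\<close> and \<open>x\<close> at other indices are irrelevant.
  The plane is identified with the complex numbers.\<close>

definition center_of_mass :: "nat \<Rightarrow> (nat \<Rightarrow> real) \<Rightarrow> (nat \<Rightarrow> complex) \<Rightarrow> complex" where
  "center_of_mass n m x =
     (\<Sum>j\<in>{1..n}. complex_of_real (m j) * x j) / complex_of_real (\<Sum>j\<in>{1..n}. m j)"

definition planar_central_configuration ::
    "nat \<Rightarrow> (nat \<Rightarrow> real) \<Rightarrow> (nat \<Rightarrow> complex) \<Rightarrow> real \<Rightarrow> bool" where
  "planar_central_configuration n m x \<omega> \<longleftrightarrow>
     (\<forall>j\<in>{1..n}. m j > 0) \<and>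
     inj_on x {1..n} \<and>
     (\<forall>k\<in>{1..n}.
        (\<Sum>j\<in>{1..n} - {k}.
           complex_of_real (m j * m k / cmod (x j - x k) ^ 3) * (x j - x k))
        = - complex_of_real (\<omega>\<^sup>2 * m k) * (x k - center_of_mass n m x))"

definition csc :: "real \<Rightarrow> real" where
  "csc t = 1 / sin t"

end

theory Submission
  imports Defs
begin

text \<open>
  Regard the masses as a function \<open>a\<close> on the group of \<open>N\<close>-th roots of unity and put
  \<open>S = \<Sum>\<^sub>w a w w\<close>. The equation of the central body says \<open>\<omega>\<^sup>2 c\<^sub>0 = S\<close>, so the equations of the outer
  bodies read \<open>\<Sum>\<^sub>w a w (w - k) / \<bar>w - k\<bar>\<^sup>3 = c k + S\<close> with the real constant
  \<open>c = m\<^sub>N\<^sub>+\<^sub>1 - \<omega>\<^sup>2\<close>. With \<open>Q\<^sub>p = \<Sum>\<^sub>v v\<^sup>p / \<bar>v - 1\<bar>\<^sup>3\<close>, taking Fourier coefficients of this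
  equation and of its complex conjugate (the masses are real) gives, for the Fourier coefficients
  \<open>A\<^sub>p\<close> of \<open>a\<close>, that \<open>A\<^sub>p (Q\<^sub>p\<^sub>-\<^sub>1 - Q\<^sub>p) = A\<^sub>p (Q\<^sub>p\<^sub>+\<^sub>1 - Q\<^sub>p) = 0\<close> for \<open>2 \<le> p \<le> N - 2\<close>.
  The second differences of \<open>Q\<close> are \<open>- T\<^sub>p\<close> with \<open>T\<^sub>p = \<Sum>\<^sub>v v\<^sup>p / \<bar>v - 1\<bar>\<close>, and those of \<open>T\<close> are
  \<open>- \<Sum>\<^sub>v v\<^sup>p \<bar>v - 1\<bar>\<close>, a difference of cotangents of known sign. So \<open>T\<close> is convex and symmetric about
  \<open>N / 2\<close>, hence decreasing up to \<open>N / 2\<close>; this excludes \<open>Q\<^sub>p\<^sub>-\<^sub>1 = Q\<^sub>p = Q\<^sub>p\<^sub>+\<^sub>1\<close>, so \<open>A\<^sub>p = 0\<close>.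
  For \<open>p = 1\<close>, where \<open>A\<^sub>1 = S\<close>, a nonzero \<open>S\<close> would force \<open>Q\<^sub>0 - Q\<^sub>1 = N\<close> and \<open>Q\<^sub>2 = Q\<^sub>1\<close>, hence
  \<open>T\<^sub>0 = 2 N\<close> and \<open>T\<^sub>1 = - N\<close>, although \<open>T\<^sub>0 - T\<^sub>1\<close> is a sum of \<open>N - 1\<close> sines (for \<open>N = 2\<close>, already
  \<open>T\<^sub>0 = 1/2\<close>). So \<open>a\<close> is constant, and one equation determines its value.
\<close>

subsection \<open>Cosine sums weighted by powers of chord lengths\<close>

text \<open>For \<open>v = cis (2 * pi * l / N)\<close> the factor \<open>2 * sin (pi * l / N)\<close> is the chord length \<open>\<bar>v - 1\<bar>\<close>;
  \<open>Q\<close> and \<open>T\<close> above are the cases \<open>r = -3\<close> and \<open>r = -1\<close>.\<close>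
definition chord_sum :: "nat \<Rightarrow> int \<Rightarrow> nat \<Rightarrow> real" where
  "chord_sum N r p =
     (\<Sum>l=1..<N. (2 * sin (pi * real l / real N)) powi r * cos (2 * pi * real p * real l / real N))"

lemma sin_chord_pos:
  assumes "l \<in> {1..<N}"
  shows "sin (pi * real l / real N) > 0"
  using assms by (intro sin_gt_zero) (auto simp: field_simps)

text \<open>From cos (x + 2 t) + cos (x - 2 t) - 2 cos x = - (2 sin t)^2 cos x: each second
  difference in the frequency raises the exponent of the chord length by 2.\<close>

lemma chord_sum_second_difference:
  "chord_sum N r (Suc (Suc p)) + chord_sum N r p - 2 * chord_sum N r (Suc p)
     = - chord_sum N (r + 2) (Suc p)"
proof -
  have "(2 * sin (pi * real l / real N)) powi r * cos (2 * pi * real (Suc (Suc p)) * real l / real N)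
      + (2 * sin (pi * real l / real N)) powi r * cos (2 * pi * real p * real l / real N)
      - 2 * ((2 * sin (pi * real l / real N)) powi r * cos (2 * pi * real (Suc p) * real l / real N))
      = - ((2 * sin (pi * real l / real N)) powi (r + 2) * cos (2 * pi * real (Suc p) * real l / real N))"
    if l: "l \<in> {1..<N}" for l
  proof -
    define t where "t = pi * real l / real N"
    define \<alpha> where "\<alpha> = 2 * pi * real (Suc p) * real l / real N"
    have s: "sin t > 0"
      using sin_chord_pos[OF l] by (simp add: t_def)
    have plus: "2 * pi * real (Suc (Suc p)) * real l / real N = \<alpha> + 2 * t"
      and minus: "2 * pi * real p * real l / real N = \<alpha> - 2 * t"
      by (simp_all add: \<alpha>_def t_def field_simps add_divide_distrib diff_divide_distrib)
    have c: "cos (\<alpha> + 2 * t) + cos (\<alpha> - 2 * t) - 2 * cos \<alpha> = - ((2 * sin t) ^ 2 * cos \<alpha>)"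
      unfolding cos_add cos_diff cos_double_sin by (simp add: algebra_simps power2_eq_square)
    have "(2 * sin t) powi (r + 2) = (2 * sin t) powi r * (2 * sin t) ^ 2"
      using s by (simp add: power_int_add)
    then show ?thesis
      using arg_cong[OF c, of "\<lambda>y. (2 * sin t) powi r * y"]
      unfolding plus minus \<alpha>_def[symmetric] t_def[symmetric]
      by (simp add: algebra_simps)
  qed
  then show ?thesis
    unfolding chord_sum_def sum_distrib_left sum_negf[symmetric] sum.distrib[symmetric]
      sum_subtractf[symmetric]
    by (intro sum.cong) auto
qed

lemma chord_sum_reflect:
  assumes "p \<le> N" "N > 0"
  shows "chord_sum N r (N - p) = chord_sum N r p"
  unfolding chord_sum_def
proof (intro sum.cong refl)
  fix l
  have "2 * pi * real (N - p) * real l / real N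
      = 2 * pi * of_int (int l) - 2 * pi * real p * real l / real N"
    using assms by (simp add: of_nat_diff field_simps)
  then show "(2 * sin (pi * real l / real N)) powi r * cos (2 * pi * real (N - p) * real l / real N)
      = (2 * sin (pi * real l / real N)) powi r * cos (2 * pi * real p * real l / real N)"
    by (simp only: cos_diff cos_int_2pin sin_int_2pin) simp
qed

text \<open>Multiplying by \<open>2 * sin h\<close>, where \<open>2 * h\<close> is the step of the
  angles, makes the sum telescope. As \<open>q\<close> is odd, cos (q pi - h) = - cos h, so both
  ends contribute \<open>cos h\<close>.\<close>

lemma sum_sin_odd_multiple:
  assumes "odd q" "q < 2 * N"
  shows "(\<Sum>l=1..<N. sin (real l * (real q * pi / real N))) = cot (real q * pi / real (2 * N))"
proof -
  define h where "h = real q * pi / real (2 * N)"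
  have N: "N > 0" using assms by auto
  have q: "q > 0" using assms by (auto intro: Nat.gr0I)
  have hpos: "sin h > 0"
    using sin_chord_pos[of q "2 * N"] assms q by (simp add: h_def mult.commute)
  have h2: "real q * pi / real N = 2 * h"
    using N by (simp add: h_def)
  have "2 * sin h * (\<Sum>l=1..<N. sin (real l * (2 * h)))
      = (\<Sum>l=1..<N. - cos (real (2 * Suc l - 1) * h) - - cos (real (2 * l - 1) * h))"
    unfolding sum_distrib_left
  proof (intro sum.cong refl)
    fix l assume "l \<in> {1..<N}"
    then have "real (2 * Suc l - 1) * h = real l * (2 * h) + h"
      "real (2 * l - 1) * h = real l * (2 * h) - h"
      by (simp_all add: of_nat_diff algebra_simps)
    then show "2 * sin h * sin (real l * (2 * h))
        = - cos (real (2 * Suc l - 1) * h) - - cos (real (2 * l - 1) * h)"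
      by (simp only: cos_add cos_diff) simp
  qed
  also have "\<dots> = - cos (real (2 * N - 1) * h) - - cos h"
    using sum_Suc_diff'[of 1 N "\<lambda>l. - cos (real (2 * l - 1) * h)"] N by simp
  also have "real (2 * N - 1) * h = real q * pi - h"
    using N by (simp add: h_def of_nat_diff field_simps)
  also have "cos (real q * pi - h) = - cos h"
    using assms(1) by (simp add: cos_diff cos_npi)
  finally show ?thesis
    using hpos unfolding h2 h_def[symmetric] by (simp add: cot_def field_simps)
qed

text \<open>By 2 sin t cos u = sin (u + t) - sin (u - t) the sum becomes two sine sums at odd
  multiples, hence \<open>cot \<alpha> - cot \<beta>\<close> with 0 < \<beta> < \<alpha> < pi, where
  the cotangent decreases.\<close>

lemma chord_sum_1_nonpos:
  assumes "p \<ge> 1" "p < N"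
  shows "chord_sum N 1 p \<le> 0"
proof -
  have N: "N > 0" using assms by auto
  define \<alpha> \<beta> where "\<alpha> = real (2 * p + 1) * pi / real (2 * N)"
    and "\<beta> = real (2 * p - 1) * pi / real (2 * N)"
  have bounds: "2 * p + 1 < 2 * N" "2 * p - 1 < 2 * N" "2 * p - 1 > 0"
    using assms by linarith+
  have pos: "sin \<alpha> > 0" "sin \<beta> > 0"
    using sin_chord_pos[of "2 * p + 1" "2 * N"] sin_chord_pos[of "2 * p - 1" "2 * N"] bounds
    by (simp_all add: \<alpha>_def \<beta>_def mult.commute)
  have "\<alpha> - \<beta> = pi / real N"
    using assms N by (simp add: \<alpha>_def \<beta>_def of_nat_diff field_simps)
  moreover have "pi / real N \<le> pi"
    using N by (simp add: divide_le_eq)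
  ultimately have "sin (\<alpha> - \<beta>) \<ge> 0"
    by (simp only:) (rule sin_ge_zero, auto)
  then have "cos \<alpha> * sin \<beta> \<le> cos \<beta> * sin \<alpha>"
    by (simp add: sin_diff mult.commute)
  then have le: "cot \<alpha> \<le> cot \<beta>"
    using pos by (simp add: cot_def divide_simps mult.commute)
  have "chord_sum N 1 p = (\<Sum>l=1..<N. sin (real l * (real (2 * p + 1) * pi / real N))
      - sin (real l * (real (2 * p - 1) * pi / real N)))"
    unfolding chord_sum_def
  proof (intro sum.cong refl)
    fix l assume "l \<in> {1..<N}"
    define t where "t = pi * real l / real N"
    define u where "u = 2 * pi * real p * real l / real N"
    have "real l * (real (2 * p + 1) * pi / real N) = u + t"
      "real l * (real (2 * p - 1) * pi / real N) = u - t"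
      using assms N by (simp_all add: t_def u_def of_nat_diff field_simps)
    then show "(2 * sin (pi * real l / real N)) powi 1 * cos (2 * pi * real p * real l / real N)
      = sin (real l * (real (2 * p + 1) * pi / real N))
      - sin (real l * (real (2 * p - 1) * pi / real N))"
      unfolding t_def[symmetric] u_def[symmetric]
      by (simp only: sin_add sin_diff) simp
  qed
  also have "\<dots> = cot \<alpha> - cot \<beta>"
    unfolding sum_subtractf \<alpha>_def \<beta>_def
    using bounds by (subst (1 2) sum_sin_odd_multiple) auto
  finally show ?thesis using le by simp
qed

lemma chord_sum_minus1_antimono:
  assumes "p \<le> q" "2 * q \<le> N" "N > 0"
  shows "chord_sum N (-1) q \<le> chord_sum N (-1) p"
proof -
  define e where "e p = chord_sum N (-1) (Suc p) - chord_sum N (-1) p" for p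
  have step: "e p \<le> e (Suc p)" if "Suc p < N" for p
    using chord_sum_second_difference[of N "-1" p] chord_sum_1_nonpos[of "Suc p" N] that
    by (simp add: e_def)
  have mono: "e p \<le> e q" if "p \<le> q" "q < N" for p q
    using that by (induction q rule: dec_induct) (auto intro: order_trans step)
  have neg: "e p \<le> 0" if "2 * Suc p \<le> N" for p
  proof -
    \<comment> \<open>Increments grow by convexity, while the increment at the mirrored place
      \<open>N - Suc p\<close> is the negative of the one at \<open>p\<close>.\<close>
    have "e p \<le> e (N - Suc p)"
      using that by (intro mono) auto
    also have "\<dots> = - e p"
      using chord_sum_reflect[of p N "-1"] chord_sum_reflect[of "Suc p" N "-1"] that
      by (simp add: e_def Suc_diff_Suc)
    finally show ?thesis by simp
  qed
  have antimono_step: "chord_sum N (-1) (Suc p) \<le> chord_sum N (-1) p" if "2 * Suc p \<le> N" for p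
    using neg[OF that] by (simp add: e_def)
  show ?thesis
    using assms(1,2) by (induction q rule: dec_induct) (auto intro: order_trans[OF antimono_step])
qed

text \<open>Termwise from 1 - cos 2t = 2 (sin t)^2. The first identity starts the recursion for the
  differences of \<open>Q\<close>, the second bounds \<open>T\<^sub>0 - T\<^sub>1\<close>.\<close>

lemma chord_sum_difference_0:
  "chord_sum N (-3) 0 - chord_sum N (-3) 1 = chord_sum N (-1) 0 / 2"
  and chord_sum_difference_0':
  "chord_sum N (-1) 0 - chord_sum N (-1) 1 = (\<Sum>l=1..<N. sin (pi * real l / real N))"
proof -
  have *: "1 - cos (2 * pi * real l / real N) = 2 * sin (pi * real l / real N) ^ 2" for l
    using cos_double_sin[of "pi * real l / real N"] by (simp add: algebra_simps)
  have "(2 * sin (pi * real l / real N)) powi (-3) * (1 - cos (2 * pi * real l / real N))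
      = (2 * sin (pi * real l / real N)) powi (-1) / 2" if "l \<in> {1..<N}" for l
    using sin_chord_pos[OF that] unfolding *
    by (simp add: power_int_minus field_simps power2_eq_square power3_eq_cube)
  then show "chord_sum N (-3) 0 - chord_sum N (-3) 1 = chord_sum N (-1) 0 / 2"
    unfolding chord_sum_def sum_subtractf[symmetric] sum_divide_distrib
    by (intro sum.cong) (auto simp: algebra_simps)
  have "(2 * sin (pi * real l / real N)) powi (-1) * (1 - cos (2 * pi * real l / real N))
      = sin (pi * real l / real N)" if "l \<in> {1..<N}" for l
    using sin_chord_pos[OF that] unfolding *
    by (simp add: power_int_minus field_simps power2_eq_square)
  then show "chord_sum N (-1) 0 - chord_sum N (-1) 1 = (\<Sum>l=1..<N. sin (pi * real l / real N))"
    unfolding chord_sum_def sum_subtractf[symmetric]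
    by (intro sum.cong) (auto simp: algebra_simps)
qed

lemma chord_sum_minus1_0_pos:
  assumes "N \<ge> 2"
  shows "chord_sum N (-1) 0 > 0"
  unfolding chord_sum_def using assms sin_chord_pos
  by (intro sum_pos) auto


text \<open>Two flat steps make \<open>T\<close> vanish at \<open>Suc r\<close>. Since
  \<open>T\<close> decreases up to N / 2, it is nonnegative before that, so the differences
  \<open>D\<close> of \<open>Q\<close> never increase from \<open>D 0 < 0\<close>, and
  \<open>D r = 0\<close> is impossible.\<close>

lemma chord_sum_minus3_not_flat_half:
  assumes "2 * Suc r \<le> N" "chord_sum N (-3) r = chord_sum N (-3) (Suc r)"
  shows "chord_sum N (-3) (Suc (Suc r)) \<noteq> chord_sum N (-3) (Suc r)"
proof
  assume flat: "chord_sum N (-3) (Suc (Suc r)) = chord_sum N (-3) (Suc r)"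
  define D where "D q = chord_sum N (-3) (Suc q) - chord_sum N (-3) q" for q
  have D_step: "D (Suc q) = D q - chord_sum N (-1) (Suc q)" for q
    using chord_sum_second_difference[of N "-3" q] by (simp add: D_def)
  have zero: "chord_sum N (-1) (Suc r) = 0"
    using D_step[of r] flat assms(2) by (simp add: D_def)
  have "D q < 0" if "q \<le> r" for q
    using that
  proof (induction q)
    case 0
    show ?case
      using chord_sum_difference_0[of N] chord_sum_minus1_0_pos[of N] assms(1) by (simp add: D_def)
  next
    case (Suc q)
    then have "chord_sum N (-1) (Suc q) \<ge> 0"
      using chord_sum_minus1_antimono[of "Suc q" "Suc r" N] assms(1) zero by simp
    then show ?case
      using Suc D_step[of q] by simp
  qed
  from this[of r] assms(2) show False
    by (simp add: D_def)
qed

text \<open>A triple centred beyond N / 2 is mirrored to one centred below it; this reverses its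
  order, which does not affect flatness.\<close>

lemma chord_sum_minus3_not_flat:
  assumes "Suc r < N" "chord_sum N (-3) r = chord_sum N (-3) (Suc r)"
  shows "chord_sum N (-3) (Suc (Suc r)) \<noteq> chord_sum N (-3) (Suc r)"
proof (cases "2 * Suc r \<le> N")
  case True
  then show ?thesis using chord_sum_minus3_not_flat_half assms(2) by blast
next
  case False
  define r' where "r' = N - Suc (Suc r)"
  have "Suc r' = N - Suc r" "Suc (Suc r') = N - r"
    using assms(1) by (auto simp: r'_def)
  then have "chord_sum N (-3) (Suc r') = chord_sum N (-3) (Suc r)"
    "chord_sum N (-3) (Suc (Suc r')) = chord_sum N (-3) r"
    "chord_sum N (-3) r' = chord_sum N (-3) (Suc (Suc r))"
    using assms(1) chord_sum_reflect[of _ N "-3"] by (simp_all add: r'_def)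
  moreover have "2 * Suc r' \<le> N"
    using False assms(1) by (simp add: r'_def)
  ultimately show ?thesis
    using chord_sum_minus3_not_flat_half[of r' N] assms(2) by auto
qed

subsection \<open>Sums over roots of unity\<close>

definition unity_roots :: "nat \<Rightarrow> complex set" where
  "unity_roots N = {w. w ^ N = 1}"

lemma unity_roots_mult: "u \<in> unity_roots N \<Longrightarrow> v \<in> unity_roots N \<Longrightarrow> u * v \<in> unity_roots N"
  and unity_roots_divide: "u \<in> unity_roots N \<Longrightarrow> v \<in> unity_roots N \<Longrightarrow> u / v \<in> unity_roots N"
  and one_in_unity_roots: "1 \<in> unity_roots N"
  by (simp_all add: unity_roots_def power_mult_distrib power_divide)

lemma norm_unity_root:
  assumes "u \<in> unity_roots N" "N > 0"
  shows "norm u = 1"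
  using power_eq_1_iff[of u N] assms by (simp add: unity_roots_def)

lemma cnj_unity_root:
  assumes "u \<in> unity_roots N" "N > 0"
  shows "cnj u = inverse u"
  using inverse_unique[of u "cnj u"] complex_norm_square[of u] norm_unity_root[OF assms] by simp

lemma unity_root_nonzero: "u \<in> unity_roots N \<Longrightarrow> N > 0 \<Longrightarrow> u \<noteq> 0"
  using norm_unity_root by force

lemma finite_unity_roots: "N > 0 \<Longrightarrow> finite (unity_roots N)"
  by (simp add: unity_roots_def finite_roots_unity)

lemma card_unity_roots: "N > 0 \<Longrightarrow> card (unity_roots N) = N"
  by (simp add: unity_roots_def card_roots_unity_eq)

lemma sum_unity_roots_translate:
  fixes f :: "complex \<Rightarrow> 'a::comm_monoid_add"
  assumes "u \<in> unity_roots N" "N > 0"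
  shows "(\<Sum>w\<in>unity_roots N - {u}. f w) = (\<Sum>v\<in>unity_roots N - {1}. f (u * v))"
  using unity_root_nonzero[OF assms] assms
  by (intro sum.reindex_bij_witness[of _ "\<lambda>v. u * v" "\<lambda>w. w / u"])
     (auto simp: unity_roots_mult unity_roots_divide)

text \<open>Multiplication by the primitive root \<open>z\<close> permutes the roots and scales the
  sum by \<open>z ^ p\<close>, which is not 1.\<close>

lemma sum_unity_roots_power_eq_0:
  assumes "1 \<le> p" "p < N"
  shows "(\<Sum>w\<in>unity_roots N. w ^ p) = 0"
proof -
  have N: "N > 0" using assms by simp
  note bij = Complex.bij_betw_roots_unity[OF N]
  define z where "z = cis (2 * pi / real N)"
  have z: "z \<in> unity_roots N"
    using N by (simp add: unity_roots_def z_def Complex.DeMoivre)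
  have "z ^ p = cis (2 * pi * real p / real N)"
    by (simp add: z_def Complex.DeMoivre mult.commute)
  also have "\<dots> \<noteq> cis (2 * pi * real 0 / real N)"
    using inj_onD[OF bij_betw_imp_inj_on[OF bij], of p 0] assms by auto
  finally have "z ^ p \<noteq> 1" by simp
  have "(\<Sum>w\<in>unity_roots N. w ^ p) = (\<Sum>w\<in>unity_roots N. (z * w) ^ p)"
    using unity_root_nonzero[OF z N] z
    by (intro sum.reindex_bij_witness[of _ "\<lambda>w. z * w" "\<lambda>w. w / z"])
       (auto simp: unity_roots_mult unity_roots_divide)
  also have "\<dots> = z ^ p * (\<Sum>w\<in>unity_roots N. w ^ p)"
    by (simp add: power_mult_distrib sum_distrib_left)
  finally show ?thesis using \<open>z ^ p \<noteq> 1\<close> by simp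
qed

text \<open>Fourier inversion: summing the moments divided by \<open>u ^ p\<close> isolates
  \<open>a u\<close>, and only the moment at \<open>p = 0\<close> survives.\<close>

lemma unity_roots_constant_if_moments_vanish:
  fixes a :: "complex \<Rightarrow> complex"
  assumes "N > 0"
    and moments: "\<And>p. 1 \<le> p \<Longrightarrow> p < N \<Longrightarrow> (\<Sum>w\<in>unity_roots N. a w * w ^ p) = 0"
    and u: "u \<in> unity_roots N"
  shows "a u = (\<Sum>w\<in>unity_roots N. a w) / of_nat N"
proof -
  have "(\<Sum>p<N. \<Sum>w\<in>unity_roots N. a w * (w / u) ^ p)
      = (\<Sum>p<N. (\<Sum>w\<in>unity_roots N. a w * w ^ p) / u ^ p)"
    by (simp add: power_divide sum_divide_distrib)
  also have "\<dots> = (\<Sum>p\<in>{0}. (\<Sum>w\<in>unity_roots N. a w * w ^ p) / u ^ p)"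
    using assms(1) by (intro sum.mono_neutral_right) (auto simp: moments)
  finally have 1: "(\<Sum>p<N. \<Sum>w\<in>unity_roots N. a w * (w / u) ^ p) = (\<Sum>w\<in>unity_roots N. a w)"
    by simp
  have "(\<Sum>p<N. \<Sum>w\<in>unity_roots N. a w * (w / u) ^ p)
      = (\<Sum>w\<in>unity_roots N. a w * (\<Sum>p<N. (w / u) ^ p))"
    by (subst sum.swap) (simp add: sum_distrib_left)
  also have "\<dots> = (\<Sum>w\<in>unity_roots N. if w = u then a u * of_nat N else 0)"
  proof (intro sum.cong refl)
    fix w assume "w \<in> unity_roots N"
    then have "(w / u) ^ N = 1"
      using unity_roots_divide[OF _ u] by (simp add: unity_roots_def)
    then show "a w * (\<Sum>p<N. (w / u) ^ p) = (if w = u then a u * of_nat N else 0)"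
      using unity_root_nonzero[OF u assms(1)] by (auto simp: sum_gp_strict)
  qed
  also have "\<dots> = a u * of_nat N"
    using u finite_unity_roots[OF assms(1)] by simp
  finally show ?thesis
    using 1 assms(1) by (simp add: field_simps)
qed

text \<open>The left side is \<open>Q\<^sub>p\<close>; it is real because \<open>v\<close> and its
  conjugate are equally far from 1.\<close>

lemma sum_unity_roots_chord:
  assumes "N > 0"
  shows "(\<Sum>v\<in>unity_roots N - {1}. v ^ p / of_real (norm (v - 1) ^ 3))
      = complex_of_real (chord_sum N (-3) p)"
proof -
  note bij = Complex.bij_betw_roots_unity[OF assms]
  define s where "s l = 2 * sin (pi * real l / real N)" for l
  define \<theta> where "\<theta> l = 2 * pi * real p * real l / real N" for l
  have "bij_betw (\<lambda>k. cis (2 * pi * real k / real N)) ({..<N} - {0}) (unity_roots N - {1})"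
    using bij_betw_DiffI[OF bij bij_betw_singletonI[of _ 0 1]] assms
    by (simp add: unity_roots_def)
  moreover have "{..<N} - {0} = {1..<N}" by auto
  ultimately have bij': "bij_betw (\<lambda>k. cis (2 * pi * real k / real N)) {1..<N} (unity_roots N - {1})"
    by simp
  have "(\<Sum>v\<in>unity_roots N - {1}. v ^ p / complex_of_real (norm (v - 1) ^ 3))
      = (\<Sum>l=1..<N. cis (2 * pi * real l / real N) ^ p
           / complex_of_real (norm (cis (2 * pi * real l / real N) - 1) ^ 3))"
    by (rule sum.reindex_bij_betw[OF bij', symmetric])
  also have "\<dots> = (\<Sum>l=1..<N. of_real (s l powi (-3)) * cis (\<theta> l))"
  proof (intro sum.cong refl)
    fix l assume l: "l \<in> {1..<N}"
    define t where "t = pi * real l / real N"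
    have "cis (2 * t) - 1 = 2 * \<i> * of_real (sin t) * cis t"
      by (simp add: complex_eq_iff cos_double_sin sin_double power2_eq_square)
    then have "norm (cis (2 * t) - 1) = 2 * sin t"
      using sin_chord_pos[OF l] by (simp add: norm_mult t_def)
    then have "norm (cis (2 * pi * real l / real N) - 1) = s l"
      by (simp add: t_def s_def mult.assoc)
    moreover have "cis (2 * pi * real l / real N) ^ p = cis (\<theta> l)"
      by (simp add: Complex.DeMoivre \<theta>_def mult_ac)
    ultimately show "cis (2 * pi * real l / real N) ^ p
        / complex_of_real (norm (cis (2 * pi * real l / real N) - 1) ^ 3)
        = of_real (s l powi (-3)) * cis (\<theta> l)"
      by (simp add: power_int_minus field_simps)
  qed
  also have "\<dots> = of_real (chord_sum N (-3) p)"
  proof (rule complex_eqI)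
    show "Re (\<Sum>l=1..<N. of_real (s l powi (-3)) * cis (\<theta> l)) = Re (of_real (chord_sum N (-3) p))"
      by (simp add: chord_sum_def s_def \<theta>_def del: of_real_power_int)
    \<comment> \<open>Replacing \<open>l\<close> by \<open>N - l\<close> keeps the chord and negates
      the sine, so the sum equals its own negative.\<close>
    have "(\<Sum>l=1..<N. s l powi (-3) * sin (\<theta> l)) = (\<Sum>l=1..<N. - (s l powi (-3) * sin (\<theta> l)))"
    proof (intro sum.reindex_bij_witness[of _ "\<lambda>l. N - l" "\<lambda>l. N - l"])
      fix l assume l: "l \<in> {1..<N}"
      have "pi * real (N - l) / real N = pi - pi * real l / real N"
        using l by (simp add: of_nat_diff field_simps)
      then have "s (N - l) = s l" by (simp add: s_def)
      moreover have "\<theta> (N - l) = 2 * pi * of_int (int p) - \<theta> l"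
        using l by (simp add: \<theta>_def of_nat_diff field_simps)
      then have "sin (\<theta> (N - l)) = - sin (\<theta> l)"
        by (simp add: sin_diff del: of_int_of_nat_eq)
      ultimately show "- (s (N - l) powi (-3) * sin (\<theta> (N - l))) = s l powi (-3) * sin (\<theta> l)"
        by simp
    qed auto
    then show "Im (\<Sum>l=1..<N. of_real (s l powi (-3)) * cis (\<theta> l)) = Im (of_real (chord_sum N (-3) p))"
      by (simp add: sum_negf del: of_real_power_int)
  qed
  finally show ?thesis .
qed


text \<open>Substituting \<open>k = w * v\<close> pulls out a power of \<open>w\<close>, as
  \<open>norm w = 1\<close>. In the second sum conjugation is inversion and costs one power, so
  \<open>k ^ Suc p\<close> keeps the exponents natural.\<close>

lemma unity_root_diff_powers:
  assumes "w \<in> unity_roots N" "N > 0"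
  shows "(\<Sum>k\<in>unity_roots N - {w}. (w - k) * k ^ p / of_real (norm (w - k) ^ 3))
      = w ^ Suc p * complex_of_real (chord_sum N (-3) p - chord_sum N (-3) (Suc p))"
    (is ?A)
  and "(\<Sum>k\<in>unity_roots N - {w}. (cnj w - cnj k) * k ^ Suc p / of_real (norm (w - k) ^ 3))
      = w ^ p * complex_of_real (chord_sum N (-3) (Suc p) - chord_sum N (-3) p)"
    (is ?B)
proof -
  have norm_eq: "norm (w - w * v) = norm (v - 1)" for v
  proof -
    have "w - w * v = w * (1 - v)"
      by (simp add: algebra_simps)
    then show ?thesis
      using norm_unity_root[OF assms] by (simp add: norm_mult norm_minus_commute)
  qed
  note simps = sum_unity_roots_translate[OF assms] norm_eq
    sum_unity_roots_chord[OF assms(2), symmetric] of_real_diff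
  show ?A
    unfolding simps sum_subtractf[symmetric] sum_distrib_left
    by (intro sum.cong refl) (simp add: power_mult_distrib algebra_simps diff_divide_distrib)
  show ?B
    unfolding simps sum_subtractf[symmetric] sum_distrib_left
  proof (intro sum.cong refl)
    fix v assume "v \<in> unity_roots N - {1}"
    then have v: "v \<in> unity_roots N" by simp
    have "(cnj w - cnj (w * v)) * (w * v) ^ Suc p = w ^ p * (v ^ Suc p - v ^ p)"
      using unity_root_nonzero[OF assms] unity_root_nonzero[OF v assms(2)]
      by (simp add: cnj_unity_root[OF assms] cnj_unity_root[OF v assms(2)] power_mult_distrib field_simps)
    then show "(cnj w - cnj (w * v)) * (w * v) ^ Suc p / of_real (norm (v - 1) ^ 3)
        = w ^ p * (v ^ Suc p / of_real (norm (v - 1) ^ 3) - v ^ p / of_real (norm (v - 1) ^ 3))"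
      by (simp only: diff_divide_distrib[symmetric] times_divide_eq_right)
  qed
qed

subsection \<open>Masses at the vertices of a polygon\<close>

lemma sum_off_diagonal_swap:
  fixes g :: "'a \<Rightarrow> 'a \<Rightarrow> 'b::comm_monoid_add"
  assumes "finite G"
  shows "(\<Sum>k\<in>G. \<Sum>w\<in>G - {k}. g k w) = (\<Sum>w\<in>G. \<Sum>k\<in>G - {w}. g k w)"
proof -
  have "(\<Sum>k\<in>G. \<Sum>w\<in>{w\<in>G. w \<noteq> k}. g k w) = (\<Sum>w\<in>G. \<Sum>k\<in>{k\<in>G. w \<noteq> k}. g k w)"
    by (rule sum.swap_restrict[OF assms assms])
  moreover have "{w\<in>G. w \<noteq> k} = G - {k}" "{w\<in>G. k \<noteq> w} = G - {k}" for k
    by auto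
  ultimately show ?thesis by simp
qed

lemma polygon_masses_equal:
  fixes a :: "complex \<Rightarrow> real" and c :: real
  assumes N: "N \<ge> 2"
    and S: "S = (\<Sum>w\<in>unity_roots N. of_real (a w) * w)"
    and eq: "\<And>k. k \<in> unity_roots N \<Longrightarrow>
      (\<Sum>w\<in>unity_roots N - {k}. of_real (a w / norm (w - k) ^ 3) * (w - k)) = of_real c * k + S"
    and u: "u \<in> unity_roots N"
  shows "a u = (\<Sum>w\<in>unity_roots N. a w) / real N"
proof -
  have N0: "N > 0" using N by simp
  define A where "A p = (\<Sum>w\<in>unity_roots N. of_real (a w) * w ^ p)" for p
  have moment: "A (Suc p) * complex_of_real (chord_sum N (-3) p - chord_sum N (-3) (Suc p))
      = of_real c * (\<Sum>k\<in>unity_roots N. k ^ Suc p) + S * (\<Sum>k\<in>unity_roots N. k ^ p)" for p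
  proof -
    have "A (Suc p) * complex_of_real (chord_sum N (-3) p - chord_sum N (-3) (Suc p))
      = (\<Sum>w\<in>unity_roots N. \<Sum>k\<in>unity_roots N - {w}.
           of_real (a w) * ((w - k) * k ^ p / of_real (norm (w - k) ^ 3)))"
      unfolding A_def sum_distrib_right sum_distrib_left[symmetric]
      by (intro sum.cong refl) (simp only: unity_root_diff_powers(1)[OF _ N0] mult.assoc)
    also have "\<dots> = (\<Sum>k\<in>unity_roots N. \<Sum>w\<in>unity_roots N - {k}.
           of_real (a w) * ((w - k) * k ^ p / of_real (norm (w - k) ^ 3)))"
      by (rule sum_off_diagonal_swap[OF finite_unity_roots[OF N0], symmetric])
    also have "\<dots> = (\<Sum>k\<in>unity_roots N. (of_real c * k + S) * k ^ p)"
      by (intro sum.cong refl) (simp add: eq[symmetric] sum_distrib_right mult.assoc)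
    finally show ?thesis
      by (simp add: sum_distrib_left sum.distrib algebra_simps)
  qed
  \<comment> \<open>The same for the conjugate equation, tested against \<open>k ^ Suc p\<close>.
    Since \<open>a\<close> and \<open>c\<close> are real, the same coefficients \<open>A\<close>
    appear.\<close>
  have moment_cnj: "A p * complex_of_real (chord_sum N (-3) (Suc p) - chord_sum N (-3) p)
      = of_real c * (\<Sum>k\<in>unity_roots N. k ^ p) + cnj S * (\<Sum>k\<in>unity_roots N. k ^ Suc p)" for p
  proof -
    have "A p * complex_of_real (chord_sum N (-3) (Suc p) - chord_sum N (-3) p)
      = (\<Sum>w\<in>unity_roots N. \<Sum>k\<in>unity_roots N - {w}.
           of_real (a w) * ((cnj w - cnj k) * k ^ Suc p / of_real (norm (w - k) ^ 3)))"
      unfolding A_def sum_distrib_right sum_distrib_left[symmetric]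
      by (intro sum.cong refl) (simp only: unity_root_diff_powers(2)[OF _ N0] mult.assoc)
    also have "\<dots> = (\<Sum>k\<in>unity_roots N. \<Sum>w\<in>unity_roots N - {k}.
           of_real (a w) * ((cnj w - cnj k) * k ^ Suc p / of_real (norm (w - k) ^ 3)))"
      by (rule sum_off_diagonal_swap[OF finite_unity_roots[OF N0], symmetric])
    also have "\<dots> = (\<Sum>k\<in>unity_roots N. (of_real c * cnj k + cnj S) * k ^ Suc p)"
    proof (intro sum.cong refl)
      fix k assume k: "k \<in> unity_roots N"
      have "of_real c * cnj k + cnj S
          = (\<Sum>w\<in>unity_roots N - {k}. of_real (a w / norm (w - k) ^ 3) * (cnj w - cnj k))"
        using arg_cong[OF eq[OF k], of cnj] by simp
      then show "(\<Sum>w\<in>unity_roots N - {k}.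
           of_real (a w) * ((cnj w - cnj k) * k ^ Suc p / of_real (norm (w - k) ^ 3)))
          = (of_real c * cnj k + cnj S) * k ^ Suc p"
        by (simp add: sum_distrib_right mult.assoc)
    qed
    also have "\<dots> = (\<Sum>k\<in>unity_roots N. of_real c * k ^ p + cnj S * k ^ Suc p)"
      using unity_root_nonzero[OF _ N0]
      by (intro sum.cong refl) (simp add: cnj_unity_root[OF _ N0] field_simps)
    finally show ?thesis
      by (simp only: sum_distrib_left sum.distrib)
  qed
  have power_sum_0: "(\<Sum>k\<in>unity_roots N. k ^ p) = 0" if "1 \<le> p" "p < N" for p
    using sum_unity_roots_power_eq_0[OF that] .
  have A1: "A 1 = 0"
  proof (rule ccontr)
    assume nz: "A 1 \<noteq> 0"
    \<comment> \<open>Here the power sums of exponents 1 and 0 are 0 and \<open>N\<close>, and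
      \<open>S = A 1\<close>.\<close>
    have "A 1 * complex_of_real (chord_sum N (-3) 0 - chord_sum N (-3) 1) = A 1 * of_nat N"
      using moment[of 0] power_sum_0[of 1] N by (simp add: A_def S card_unity_roots)
    then have "complex_of_real (chord_sum N (-3) 0 - chord_sum N (-3) 1) = of_real (real N)"
      using nz by simp
    then have d0: "chord_sum N (-3) 0 - chord_sum N (-3) 1 = real N"
      unfolding of_real_eq_iff .
    then have T0: "chord_sum N (-1) 0 = 2 * real N"
      using chord_sum_difference_0[of N] by simp
    show False
    proof (cases "N = 2")
      \<comment> \<open>The argument of the other case fails here: for \<open>N = 2\<close> the
        power sum of exponent 2 is not 0.\<close>
      case True
      have "chord_sum 2 (-1) 0 = (\<Sum>l\<in>{1}. (2 * sin (pi * real l / 2)) powi (-1))"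
        unfolding chord_sum_def by (intro sum.cong) auto
      then have "chord_sum 2 (-1) 0 = 1 / 2"
        by (simp add: power_int_minus)
      then show ?thesis
        using T0 \<open>N = 2\<close> by simp
    next
      case False
      then have "A 1 * complex_of_real (chord_sum N (-3) (Suc 1) - chord_sum N (-3) 1) = 0"
        using moment_cnj[of 1] power_sum_0[of 1] power_sum_0[of "Suc 1"] N by simp
      then have "chord_sum N (-3) (Suc 1) = chord_sum N (-3) 1"
        using nz by (simp flip: of_real_diff)
      then have "chord_sum N (-1) 1 = - real N"
        using chord_sum_second_difference[of N "-3" 0] d0 by simp
      then have "3 * real N = (\<Sum>l=1..<N. sin (pi * real l / real N))"
        using T0 chord_sum_difference_0'[of N] by simp
      also have "\<dots> \<le> (\<Sum>l=1..<N. 1)"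
        by (intro sum_mono) simp
      finally show ?thesis using N by simp
    qed
  qed
  have "A p = 0" if p: "1 \<le> p" "p < N" for p
  proof -
    \<comment> \<open>Away from the two ends, the exponents p - 1, p and p + 1 all lie strictly
      between 0 and \<open>N\<close>, so every power sum on the right-hand sides vanishes.\<close>
    consider "p = 1" | "p = N - 1" | r where "p = Suc r" "r \<ge> 1" "Suc p < N"
    proof (cases p)
      case (Suc r)
      show thesis
        using that p Suc by (cases "r = 0"; cases "Suc p < N") auto
    qed (use p in simp)
    then show ?thesis
    proof cases
      case 2
      \<comment> \<open>As the masses are real, this makes the last coefficient the conjugate of
        \<open>A 1\<close>.\<close>
      have "w ^ (N - 1) = cnj w" if "w \<in> unity_roots N" for w
      proof -
        have "w * w ^ (N - 1) = 1"
          using that N0 by (simp add: unity_roots_def flip: power_Suc)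
        then show ?thesis
          using cnj_unity_root[OF that N0] by (simp add: inverse_unique)
      qed
      then have "A p = cnj (A 1)"
        by (simp add: A_def 2)
      then show ?thesis using A1 by simp
    next
      case (3 r)
      show ?thesis
      proof (rule ccontr)
        assume nz: "A p \<noteq> 0"
        have "A p * complex_of_real (chord_sum N (-3) r - chord_sum N (-3) (Suc r)) = 0"
          using moment[of r] power_sum_0[of r] power_sum_0[of "Suc r"] p 3 by simp
        moreover have "A p * complex_of_real (chord_sum N (-3) (Suc (Suc r)) - chord_sum N (-3) (Suc r)) = 0"
          using moment_cnj[of p] power_sum_0[of p] power_sum_0[of "Suc p"] p 3 by simp
        ultimately show False
          using nz chord_sum_minus3_not_flat[of r N] p 3 by simp
      qed
    qed (use A1 in simp)
  qed
  then have "complex_of_real (a u) = (\<Sum>w\<in>unity_roots N. complex_of_real (a w)) / of_nat N"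
    unfolding A_def by (intro unity_roots_constant_if_moments_vanish N0 u) auto
  also have "\<dots> = complex_of_real ((\<Sum>w\<in>unity_roots N. a w) / real N)"
    by simp
  finally show ?thesis
    unfolding of_real_eq_iff .
qed

text \<open>The coefficient is \<open>Q\<^sub>0 - Q\<^sub>1 = T\<^sub>0 / 2\<close>, and
  \<open>T\<^sub>0\<close> is half the cosecant sum; hence the factor 1/4.\<close>

lemma polygon_constant_force:
  assumes "N > 0" and k: "k \<in> unity_roots N"
  shows "(\<Sum>w\<in>unity_roots N - {k}. of_real (b / norm (w - k) ^ 3) * (w - k))
      = - of_real (b * ((1/4) * (\<Sum>j=1..N-1. csc (real j * pi / real N)))) * k"
proof -
  have "chord_sum N (-1) 0 = (\<Sum>j=1..N-1. csc (real j * pi / real N)) / 2"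
    unfolding chord_sum_def sum_divide_distrib
    using assms by (intro sum.cong) (auto simp: csc_def power_int_minus field_simps)
  then have d: "chord_sum N (-3) 0 - chord_sum N (-3) (Suc 0)
      = (1/4) * (\<Sum>j=1..N-1. csc (real j * pi / real N))"
    using chord_sum_difference_0[of N] by simp
  have "(\<Sum>w\<in>unity_roots N - {k}. of_real (b / norm (w - k) ^ 3) * (w - k))
      = - of_real b * (\<Sum>w\<in>unity_roots N - {k}. (k - w) * w ^ 0 / of_real (norm (k - w) ^ 3))"
    unfolding sum_distrib_left
    by (intro sum.cong refl) (simp add: norm_minus_commute[of k] algebra_simps diff_divide_distrib)
  then show ?thesis
    unfolding unity_root_diff_powers(1)[OF k assms(1)] d by simp
qed

section \<open>Translation of the configuration equations to the roots of unity\<close>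

theorem theorem2p1:
  fixes N :: nat and \<omega> :: real and m :: "nat \<Rightarrow> real" and x :: "nat \<Rightarrow> complex"
  assumes "N \<ge> 2"
    and "\<forall>j\<in>{1..N+1}. m j > 0"
    and "\<forall>j\<in>{1..N}. x j = exp (2 * complex_of_real pi * \<i> * of_nat j / of_nat N)"
    and "x (N+1) = 0"
  shows "planar_central_configuration (N+1) m x \<omega> \<longleftrightarrow>
    (\<forall>k\<in>{1..N}. m k = (\<omega>\<^sup>2 - m (N+1)) / ((1/4) * (\<Sum>j=1..N-1. csc (real j * pi / real N))))"
proof -
  have N0: "N > 0" using assms(1) by simp
  define C where "C = (1/4) * (\<Sum>j=1..N-1. csc (real j * pi / real N))"
  have C_pos: "C > 0"
    unfolding C_def csc_def using assms(1) sin_chord_pos[of _ N]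
    by (intro mult_pos_pos sum_pos) (auto simp: mult.commute)
  have x_cis: "x j = cis (2 * pi * real j / real N)" if "j \<in> {1..N}" for j
    using that assms(3) by (simp add: cis_conv_exp mult_ac)
  have x_image: "x ` {1..N} = unity_roots N"
  proof
    show "x ` {1..N} \<subseteq> unity_roots N"
    proof
      fix w assume "w \<in> x ` {1..N}"
      then obtain j where "w = cis (2 * pi * real j / real N)"
        using x_cis by blast
      then have "w ^ N = cis (2 * pi * of_nat j)"
        using N0 by (simp add: Complex.DeMoivre)
      then show "w \<in> unity_roots N"
        by (simp add: unity_roots_def cis_multiple_2pi)
    qed
    show "unity_roots N \<subseteq> x ` {1..N}"
    proof
      fix w assume "w \<in> unity_roots N"
      then obtain l where l: "l < N" "w = cis (2 * pi * real l / real N)"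
        using bij_betw_imp_surj_on[OF Complex.bij_betw_roots_unity[OF N0]]
        by (auto simp: unity_roots_def)
      show "w \<in> x ` {1..N}"
      \<comment> \<open>Vertices are numbered from 1 to \<open>N\<close>, so the root with exponent
        0 is \<open>x N\<close>.\<close>
      proof (cases "l = 0")
        case True
        then have "w = x N" using l N0 by (simp add: x_cis)
        then show ?thesis using N0 by auto
      next
        case False
        then show ?thesis using l by (auto simp: x_cis intro!: image_eqI[of _ _ l])
      qed
    qed
  qed
  have inj: "inj_on x {1..N}"
    by (rule eq_card_imp_inj_on) (simp_all only: x_image card_unity_roots[OF N0] card_atLeastAtMost finite_atLeastAtMost diff_Suc_1)
  have bij: "bij_betw x {1..N} (unity_roots N)"
    using inj x_image by (simp add: bij_betw_def)
  have x_root: "x k \<in> unity_roots N" if "k \<in> {1..N}" for k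
    using that x_image by blast
  have split: "{1..N+1} = insert (N+1) {1..N}" by auto
  have inj': "inj_on x {1..N+1}"
  proof -
    have "x (N+1) \<notin> x ` {1..N}"
      unfolding x_image assms(4) using unity_root_nonzero[OF _ N0] by blast
    then show ?thesis
      unfolding split using inj by (auto simp only: inj_on_insert Diff_insert_absorb)
  qed
  \<comment> \<open>The masses are transported to the group along the bijection
    \<open>x\<close>.\<close>
  define a where "a w = m (inv_into {1..N} x w)" for w
  have a_x: "a (x k) = m k" if "k \<in> {1..N}" for k
    using that inj by (simp add: a_def)
  define S where "S = (\<Sum>w\<in>unity_roots N. of_real (a w) * w)"
  define M where "M = (\<Sum>j\<in>{1..N+1}. m j)"
  have S_eq: "S = (\<Sum>j\<in>{1..N}. of_real (m j) * x j)"
    unfolding S_def sum.reindex_bij_betw[OF bij, symmetric]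
    by (intro sum.cong) (auto simp: a_x)
  have com: "center_of_mass (N+1) m x = S / of_real M"
    unfolding center_of_mass_def M_def S_eq split using assms(4) by simp
  have force: "(\<Sum>j\<in>{1..N} - {k}. of_real (m j / norm (x j - x k) ^ 3) * (x j - x k))
      = (\<Sum>w\<in>unity_roots N - {x k}. of_real (a w / norm (w - x k) ^ 3) * (w - x k))"
    if k: "k \<in> {1..N}" for k
  proof -
    have "bij_betw x ({1..N} - {k}) (unity_roots N - {x k})"
      using bij_betw_DiffI[OF bij bij_betw_singletonI[of x k "x k"]] k x_root by simp
    note reindex = sum.reindex_bij_betw[OF this, symmetric]
    show ?thesis
      unfolding reindex by (intro sum.cong) (auto simp: a_x)
  qed
  define force_balance where "force_balance k \<longleftrightarrow> (\<Sum>j\<in>{1..N+1} - {k}. complex_of_real (m j * m k / cmod (x j - x k) ^ 3) * (x j - x k))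
        = - complex_of_real (\<omega>\<^sup>2 * m k) * (x k - center_of_mass (N+1) m x)" for k
  \<comment> \<open>Dividing by \<open>m k\<close> is allowed; as \<open>x k\<close> has norm 1, the
    central body contributes \<open>- m (N+1) * x k\<close>.\<close>
  have outer: "force_balance k
      \<longleftrightarrow> (\<Sum>w\<in>unity_roots N - {x k}. of_real (a w / norm (w - x k) ^ 3) * (w - x k))
        = of_real (m (N+1) - \<omega>\<^sup>2) * x k + of_real (\<omega>\<^sup>2) * (S / of_real M)"
    if k: "k \<in> {1..N}" for k
  proof -
    have mk: "m k \<noteq> 0" using assms(2) k by force
    have "{1..N+1} - {k} = insert (N+1) ({1..N} - {k})"
      using k by auto
    then have "(\<Sum>j\<in>{1..N+1} - {k}. complex_of_real (m j * m k / cmod (x j - x k) ^ 3) * (x j - x k))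
      = of_real (m k) * ((\<Sum>j\<in>{1..N} - {k}. of_real (m j / norm (x j - x k) ^ 3) * (x j - x k))
          - of_real (m (N+1)) * x k)"
      using norm_unity_root[OF x_root[OF k] N0] assms(4)
      by (simp add: sum_distrib_left algebra_simps)
    moreover have "of_real (m k) * (F - of_real (m (N+1)) * y) = - of_real (\<omega>\<^sup>2 * m k) * (y - d)
        \<longleftrightarrow> F = of_real (m (N+1) - \<omega>\<^sup>2) * y + of_real (\<omega>\<^sup>2) * d" for F y d :: complex
    proof -
      have "- of_real (\<omega>\<^sup>2 * m k) * (y - d) = of_real (m k) * (- of_real (\<omega>\<^sup>2) * (y - d))"
        by simp
      then have "of_real (m k) * (F - of_real (m (N+1)) * y) = - of_real (\<omega>\<^sup>2 * m k) * (y - d)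
          \<longleftrightarrow> F - of_real (m (N+1)) * y = - of_real (\<omega>\<^sup>2) * (y - d)"
        using mk by (simp only: mult_cancel_left of_real_eq_0_iff) simp
      also have "\<dots> \<longleftrightarrow> F = of_real (m (N+1) - \<omega>\<^sup>2) * y + of_real (\<omega>\<^sup>2) * d"
        unfolding diff_eq_eq by (simp add: algebra_simps)
      finally show ?thesis .
    qed
    ultimately show ?thesis
      unfolding force_balance_def force[OF k] com by simp
  qed
  \<comment> \<open>All vertices are at distance 1 from the center, so the force on it is
    \<open>m (N+1) * S\<close>. The resulting equation lets \<open>S\<close> replace \<omega>^2
    times the center of mass in the outer equations.\<close>
  have center: "force_balance (N+1)
      \<longleftrightarrow> S = of_real (\<omega>\<^sup>2) * (S / of_real M)"
  proof -
    have mk: "m (N+1) \<noteq> 0" using assms(2) by force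
    have "{1..N+1} - {N+1} = {1..N}" by auto
    then have "(\<Sum>j\<in>{1..N+1} - {N+1}.
          complex_of_real (m j * m (N+1) / cmod (x j - x (N+1)) ^ 3) * (x j - x (N+1)))
        = of_real (m (N+1)) * S"
      unfolding S_eq sum_distrib_left using norm_unity_root[OF x_root N0] assms(4)
      by (auto intro!: sum.cong simp: mult_ac)
    moreover have "- complex_of_real (\<omega>\<^sup>2 * m (N+1)) * (x (N+1) - S / of_real M)
        = of_real (m (N+1)) * (of_real (\<omega>\<^sup>2) * (S / of_real M))"
      unfolding assms(4) by simp
    ultimately show ?thesis
      unfolding force_balance_def com using mk by (simp only: mult_cancel_left of_real_eq_0_iff) simp
  qed
  have pcc: "planar_central_configuration (N+1) m x \<omega> \<longleftrightarrow>
      S = of_real (\<omega>\<^sup>2) * (S / of_real M) \<and>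
      (\<forall>k\<in>{1..N}. (\<Sum>w\<in>unity_roots N - {x k}. of_real (a w / norm (w - x k) ^ 3) * (w - x k))
        = of_real (m (N+1) - \<omega>\<^sup>2) * x k + of_real (\<omega>\<^sup>2) * (S / of_real M))"
  proof -
    have "planar_central_configuration (N+1) m x \<omega> \<longleftrightarrow> (\<forall>k\<in>{1..N+1}. force_balance k)"
      unfolding planar_central_configuration_def force_balance_def using assms(2) inj' by blast
    also have "\<dots> \<longleftrightarrow> force_balance (N+1) \<and> (\<forall>k\<in>{1..N}. force_balance k)"
      unfolding split by blast
    finally show ?thesis
      by (simp only: center outer cong: ball_cong)
  qed
  have const_force: "(\<Sum>w\<in>unity_roots N - {x k}. of_real (a w / norm (w - x k) ^ 3) * (w - x k))
      = - of_real (b * C) * x k" and S_0: "S = 0"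
    if ab: "\<And>w. w \<in> unity_roots N \<Longrightarrow> a w = b" and k: "k \<in> {1..N}" for b k
  proof -
    show "(\<Sum>w\<in>unity_roots N - {x k}. of_real (a w / norm (w - x k) ^ 3) * (w - x k))
        = - of_real (b * C) * x k"
      unfolding C_def polygon_constant_force[OF N0 x_root[OF k], symmetric]
      by (intro sum.cong) (auto simp: ab)
    have "S = of_real b * (\<Sum>w\<in>unity_roots N. w ^ 1)"
      unfolding S_def sum_distrib_left by (intro sum.cong) (auto simp: ab)
    then show "S = 0"
      using sum_unity_roots_power_eq_0[of 1 N] assms(1) by simp
  qed
  show ?thesis
    unfolding C_def[symmetric]
  proof
    assume "planar_central_configuration (N+1) m x \<omega>"
    note balance = this[unfolded pcc]
    have eq: "(\<Sum>w\<in>unity_roots N - {x k}. of_real (a w / norm (w - x k) ^ 3) * (w - x k))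
        = of_real (m (N+1) - \<omega>\<^sup>2) * x k + S" if "k \<in> {1..N}" for k
      using balance[THEN conjunct2, rule_format, OF that]
      unfolding balance[THEN conjunct1, symmetric] .
    have "(\<Sum>w\<in>unity_roots N - {k}. of_real (a w / norm (w - k) ^ 3) * (w - k))
        = of_real (m (N+1) - \<omega>\<^sup>2) * k + S" if root: "k \<in> unity_roots N" for k
    proof -
      obtain j where j: "j \<in> {1..N}" "k = x j"
        using root unfolding x_image[symmetric] by blast
      show ?thesis unfolding j(2) by (rule eq[OF j(1)])
    qed
    from polygon_masses_equal[OF assms(1) S_def this]
    obtain b where b: "\<And>w. w \<in> unity_roots N \<Longrightarrow> a w = b" by blast
    show "\<forall>k\<in>{1..N}. m k = (\<omega>\<^sup>2 - m (N+1)) / C"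
    proof
      fix k assume k: "k \<in> {1..N}"
      \<comment> \<open>With \<open>S = 0\<close>, both expressions for the force are real multiples
        of the nonzero \<open>x k\<close>, so their coefficients agree.\<close>
      have "of_real (- (b * C)) * x k = of_real (m (N+1) - \<omega>\<^sup>2) * x k"
        using eq[OF k] const_force[OF b k] S_0[OF b k] by simp
      then have "b * C = \<omega>\<^sup>2 - m (N+1)"
        using unity_root_nonzero[OF x_root[OF k] N0]
        unfolding mult_cancel_right of_real_eq_iff by auto
      then show "m k = (\<omega>\<^sup>2 - m (N+1)) / C"
        using C_pos b[OF x_root[OF k]] a_x[OF k] by (simp add: field_simps)
    qed
  next
    assume eq: "\<forall>k\<in>{1..N}. m k = (\<omega>\<^sup>2 - m (N+1)) / C"
    define b where "b = (\<omega>\<^sup>2 - m (N+1)) / C"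
    have b: "a w = b" if "w \<in> unity_roots N" for w
      using that eq a_x unfolding x_image[symmetric] b_def by auto
    have "- (b * C) = m (N+1) - \<omega>\<^sup>2"
      using C_pos by (simp add: b_def)
    then have bC: "- complex_of_real (b * C) = of_real (m (N+1) - \<omega>\<^sup>2)"
      unfolding of_real_minus[symmetric] by (rule arg_cong)
    have S: "S = 0" using S_0[OF b, of 1] N0 by simp
    show "planar_central_configuration (N+1) m x \<omega>"
      unfolding pcc
    proof (intro conjI ballI)
      fix k assume k: "k \<in> {1..N}"
      show "(\<Sum>w\<in>unity_roots N - {x k}. of_real (a w / norm (w - x k) ^ 3) * (w - x k))
          = of_real (m (N+1) - \<omega>\<^sup>2) * x k + of_real (\<omega>\<^sup>2) * (S / of_real M)"
        using const_force[OF b k] unfolding bC S by simp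
    qed (simp add: S)
  qed
qed

end
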